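(* Let $\widetilde{\mathcal{S}}\subset\mathcal{S}$ be a set containing precisely one representative of each equivalence class of the relation $\sim$ on $\mathcal{S}$. Then the mapping $\Phi:\mathcal{A}_\ast\times\widetilde{\mathcal{S}}\rightarrow\mathfrak{G}_2$ defined by the formula \[ \Phi(f,\sigma)=\operatorname{span}\{f\sigma,f\} \] is a bijection from $\mathcal{A}_\ast\times\widetilde{\mathcal{S}}$ onto $\mathfrak{V}_2$.
   Context: $\mathbb{D}$ is the open unit disk in $\mathbb{C}$, and $\mathcal{A}$ is the complex vector space of all analytic functions $f:\mathbb{D}\to\mathbb{C}$. For $\psi,\varphi\in\mathcal{A}$ with $\varphi(\mathbb{D})\subset\mathbb{D}$, the operators $M_\psi,C_\varphi:\mathcal{A}\to\mathcal{A}$ are defined by $M_\psi f=\psi f$ and $C_\varphi f=f\circ\varphi$. The class $\mathcal{W}$ of weighted composition operators consists of all operators of the form $M_\psi C_\varphi$ with such $\psi,\varphi$. A set $X\subset\mathcal{A}$ separates points in $\mathcal{W}$ if the mapping $A\mapsto A|_X$ is injective on $\mathcal{W}$, i.e. for every $A_1\neq A_2$ in $\mathcal{W}$ there exists $f\in X$ with $A_1f\neq A_2f$. Spans are complex linear spans. $\mathfrak{G}_2$ denotes the family of all two-dimensional subspaces of $\mathcal{A}$, and $\mathfrak{V}_2\subset\mathfrak{G}_2$ denotes the subfamily of those $V$ that separate points in $\mathcal{W}$. $\mathcal{A}_\ast\subset\mathcal{A}$ is the set of all $f\in\mathcal{A}$ such that $0\notin f(\mathbb{D})$ and $f(0)=1$.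 $\mathcal{S}\subset\mathcal{A}$ is the family of schlicht functions, i.e. all injective analytic $\sigma:\mathbb{D}\to\mathbb{C}$ with $\sigma(0)=0$ and $\sigma'(0)=1$. For $\sigma,\tau\in\mathcal{S}$, write $\sigma\sim\tau$ if there exists $\xi\in\mathbb{C}\cup\{\infty\}$ such that $\tau=\dfrac{\sigma}{1-\frac{1}{\xi}\sigma}$ (with $\frac1\infty=0$; since $\tau\in\mathcal{S}$ it is required that $\xi\notin\sigma(\mathbb{D})$). The relation $\sim$ is an equivalence relation on $\mathcal{S}$. *)

theory Defs
  imports "HOL-Complex_Analysis.Complex_Analysis"
begin

abbreviation unit_disc :: "complex set" where
  "unit_disc \<equiv> ball 0 1"

text \<open>
  The space of analytic functions on the open unit disc. The values outside the disc are
  fixed to be 0, so that equality of elements is equality of functions on the disc.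
\<close>

typedef disc_fun =
  "{f :: complex \<Rightarrow> complex. f holomorphic_on unit_disc \<and> (\<forall>z. z \<notin> unit_disc \<longrightarrow> f z = 0)}"
  morphisms ev Abs_disc_fun
  by (rule exI[of _ "\<lambda>_. 0"]) simp

setup_lifting type_definition_disc_fun

lemma disc_fun_eqI: "(\<And>z. z \<in> unit_disc \<Longrightarrow> ev f z = ev g z) \<Longrightarrow> f = g"
  using ev[of f] ev[of g] by (intro ev_inject[THEN iffD1] ext) (smt (verit) mem_Collect_eq)

instantiation disc_fun :: comm_ring_1
begin

lift_definition zero_disc_fun :: disc_fun is "\<lambda>_. 0"
  by simp

lift_definition one_disc_fun :: disc_fun is "\<lambda>z. if z \<in> unit_disc then 1 else 0"
  by (auto intro: holomorphic_transform[of "\<lambda>_. 1"])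

lift_definition plus_disc_fun :: "disc_fun \<Rightarrow> disc_fun \<Rightarrow> disc_fun" is "\<lambda>f g z. f z + g z"
  by (auto intro: holomorphic_intros)

lift_definition uminus_disc_fun :: "disc_fun \<Rightarrow> disc_fun" is "\<lambda>f z. - f z"
  by (auto intro: holomorphic_intros)

lift_definition minus_disc_fun :: "disc_fun \<Rightarrow> disc_fun \<Rightarrow> disc_fun" is "\<lambda>f g z. f z - g z"
  by (auto intro: holomorphic_intros)

lift_definition times_disc_fun :: "disc_fun \<Rightarrow> disc_fun \<Rightarrow> disc_fun" is "\<lambda>f g z. f z * g z"
  by (auto intro: holomorphic_intros)

instance
proof
  show "(0 :: disc_fun) \<noteq> 1"
    by transfer (auto simp: fun_eq_iff intro!: exI[of _ 0])
qed (transfer; auto simp: fun_eq_iff algebra_simps)+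

end

lift_definition scale_disc_fun :: "complex \<Rightarrow> disc_fun \<Rightarrow> disc_fun" is "\<lambda>c f z. c * f z"
  by (auto intro: holomorphic_intros)

global_interpretation disc_fun: vector_space scale_disc_fun
  by unfold_locales (transfer; simp add: fun_eq_iff algebra_simps)+

definition self_map :: "disc_fun \<Rightarrow> bool" where
  "self_map \<phi> \<longleftrightarrow> ev \<phi> ` unit_disc \<subseteq> unit_disc"

definition mult_op :: "disc_fun \<Rightarrow> disc_fun \<Rightarrow> disc_fun" where
  "mult_op \<psi> f = \<psi> * f"

text \<open>Only meaningful if \<open>\<phi>\<close> maps the disc into itself; it is the zero operator otherwise.\<close>

lift_definition comp_op :: "disc_fun \<Rightarrow> disc_fun \<Rightarrow> disc_fun" is
  "\<lambda>\<phi> f z. if \<phi> ` unit_disc \<subseteq> unit_disc \<and> z \<in> unit_disc then f (\<phi> z) else 0"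
proof -
  fix \<phi> f :: "complex \<Rightarrow> complex"
  assume \<phi>: "\<phi> holomorphic_on unit_disc \<and> (\<forall>z. z \<notin> unit_disc \<longrightarrow> \<phi> z = 0)"
    and f: "f holomorphic_on unit_disc \<and> (\<forall>z. z \<notin> unit_disc \<longrightarrow> f z = 0)"
  have "(\<lambda>z. if \<phi> ` unit_disc \<subseteq> unit_disc \<and> z \<in> unit_disc then f (\<phi> z) else 0)
          holomorphic_on unit_disc"
  proof (cases "\<phi> ` unit_disc \<subseteq> unit_disc")
    case True
    with \<phi> f have "(f \<circ> \<phi>) holomorphic_on unit_disc"
      by (auto intro: holomorphic_on_compose_gen)
    then show ?thesis
      by (rule holomorphic_transform) (use True in auto)
  next
    case False
    then show ?thesis
      by simp
  qed
  then show "(\<lambda>z. if \<phi> ` unit_disc \<subseteq> unit_disc \<and> z \<in> unit_disc then f (\<phi> z) else 0)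
        holomorphic_on unit_disc \<and>
      (\<forall>z. z \<notin> unit_disc \<longrightarrow>
        (if \<phi> ` unit_disc \<subseteq> unit_disc \<and> z \<in> unit_disc then f (\<phi> z) else 0) = 0)"
    by simp
qed

definition weighted_comp_ops :: "(disc_fun \<Rightarrow> disc_fun) set" where
  "weighted_comp_ops = {mult_op \<psi> \<circ> comp_op \<phi> | \<psi> \<phi>. self_map \<phi>}"

definition separates_points :: "disc_fun set \<Rightarrow> bool" where
  "separates_points X \<longleftrightarrow>
     (\<forall>A\<^sub>1\<in>weighted_comp_ops. \<forall>A\<^sub>2\<in>weighted_comp_ops. A\<^sub>1 \<noteq> A\<^sub>2 \<longrightarrow> (\<exists>f\<in>X. A\<^sub>1 f \<noteq> A\<^sub>2 f))"

text \<open>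
  Note that \<open>disc_fun.dim\<close> is 0 for infinite-dimensional spaces, so \<open>disc_fun.dim V = 2\<close>
  does imply that \<open>V\<close> has a basis with exactly two elements.
\<close>

definition G2 :: "disc_fun set set" where
  "G2 = {V. disc_fun.subspace V \<and> disc_fun.dim V = 2}"

definition V2 :: "disc_fun set set" where
  "V2 = {V \<in> G2. separates_points V}"

definition A_star :: "disc_fun set" where
  "A_star = {f. 0 \<notin> ev f ` unit_disc \<and> ev f 0 = 1}"

definition schlicht :: "disc_fun set" where
  "schlicht = {\<sigma>. inj_on (ev \<sigma>) unit_disc \<and> ev \<sigma> 0 = 0 \<and> deriv (ev \<sigma>) 0 = 1}"

text \<open>
  The first disjunct is the case of an infinite parameter \<open>\<xi>\<close>. In the second one, the condition
  \<open>\<xi> \<notin> ev \<sigma> ` unit_disc\<close> ensures that neither \<open>\<xi>\<close> nor the denominator vanishes.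
\<close>

definition schlicht_rel :: "(disc_fun \<times> disc_fun) set" where
  "schlicht_rel = {(\<sigma>, \<tau>). \<sigma> \<in> schlicht \<and> \<tau> \<in> schlicht \<and>
     (\<tau> = \<sigma> \<or>
      (\<exists>\<xi>. \<xi> \<notin> ev \<sigma> ` unit_disc \<and>
        (\<forall>z\<in>unit_disc. ev \<tau> z = ev \<sigma> z / (1 - 1 / \<xi> * ev \<sigma> z))))}"

lemma schlicht_rel_alt:
  "(\<sigma>, \<tau>) \<in> schlicht_rel \<longleftrightarrow> \<sigma> \<in> schlicht \<and> \<tau> \<in> schlicht \<and>
     (\<exists>c. \<forall>z\<in>unit_disc. 1 - c * ev \<sigma> z \<noteq> 0 \<and> ev \<tau> z = ev \<sigma> z / (1 - c * ev \<sigma> z))"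
  (is "_ \<longleftrightarrow> _ \<and> _ \<and> ?R")
proof (cases "\<sigma> \<in> schlicht \<and> \<tau> \<in> schlicht")
  case True
  then have \<sigma>0: "0 \<in> ev \<sigma> ` unit_disc"
    by (force simp: schlicht_def)
  have "\<tau> = \<sigma> \<or> (\<exists>\<xi>. \<xi> \<notin> ev \<sigma> ` unit_disc \<and>
        (\<forall>z\<in>unit_disc. ev \<tau> z = ev \<sigma> z / (1 - 1 / \<xi> * ev \<sigma> z))) \<longleftrightarrow> ?R" (is "?L \<longleftrightarrow> _")
  proof
    assume ?L
    then show ?R
    proof (elim disjE exE conjE)
      assume "\<tau> = \<sigma>"
      then show ?R by (intro exI[of _ 0]) simp
    next
      fix \<xi>
      assume \<xi>: "\<xi> \<notin> ev \<sigma> ` unit_disc"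
        and eq: "\<forall>z\<in>unit_disc. ev \<tau> z = ev \<sigma> z / (1 - 1 / \<xi> * ev \<sigma> z)"
      from \<xi> \<sigma>0 have "\<xi> \<noteq> 0" by metis
      with \<xi> have "\<forall>z\<in>unit_disc. 1 - 1 / \<xi> * ev \<sigma> z \<noteq> 0"
        by (auto simp: field_simps)
      with eq show ?R by blast
    qed
  next
    assume ?R
    then obtain c where c: "\<And>z. z \<in> unit_disc \<Longrightarrow> 1 - c * ev \<sigma> z \<noteq> 0"
      "\<And>z. z \<in> unit_disc \<Longrightarrow> ev \<tau> z = ev \<sigma> z / (1 - c * ev \<sigma> z)" by blast
    show ?L
    proof (cases "c = 0")
      case True
      then show ?thesis using c(2) by (intro disjI1 disc_fun_eqI) simp
    next
      case False
      have "1 / c \<noteq> ev \<sigma> z" if "z \<in> unit_disc" for z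
        using c(1)[OF that] False by (auto simp: field_simps)
      then have "1 / c \<notin> ev \<sigma> ` unit_disc" by blast
      then show ?thesis using c(2) by (intro disjI2 exI[of _ "1 / c"]) simp
    qed
  qed
  then show ?thesis using True by (simp add: schlicht_rel_def)
qed (auto simp: schlicht_rel_def)

lemma equiv_schlicht_rel: "equiv schlicht schlicht_rel"
proof (rule equivI)
  show "schlicht_rel \<subseteq> schlicht \<times> schlicht"
    by (auto simp: schlicht_rel_def)
  show "refl_on schlicht schlicht_rel"
    by (auto simp: schlicht_rel_def refl_on_def)
  show "sym schlicht_rel"
  proof (rule symI)
    fix \<sigma> \<tau> assume "(\<sigma>, \<tau>) \<in> schlicht_rel"
    then obtain c where S: "\<sigma> \<in> schlicht" "\<tau> \<in> schlicht"
      and c: "\<And>z. z \<in> unit_disc \<Longrightarrow> 1 - c * ev \<sigma> z \<noteq> 0"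
        "\<And>z. z \<in> unit_disc \<Longrightarrow> ev \<tau> z = ev \<sigma> z / (1 - c * ev \<sigma> z)"
      unfolding schlicht_rel_alt by blast
    have *: "1 - (- c) * ev \<tau> z = 1 / (1 - c * ev \<sigma> z)" if "z \<in> unit_disc" for z
      unfolding c(2)[OF that] using c(1)[OF that] by (simp add: divide_simps)
    have "1 - (- c) * ev \<tau> z \<noteq> 0 \<and> ev \<sigma> z = ev \<tau> z / (1 - (- c) * ev \<tau> z)"
      if "z \<in> unit_disc" for z
      unfolding *[OF that] unfolding c(2)[OF that] using c(1)[OF that] by simp
    then show "(\<tau>, \<sigma>) \<in> schlicht_rel"
      unfolding schlicht_rel_alt using S by blast
  qed
  show "trans schlicht_rel"
  proof (rule transI)
    fix \<sigma> \<tau> \<rho> assume "(\<sigma>, \<tau>) \<in> schlicht_rel" "(\<tau>, \<rho>) \<in> schlicht_rel"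
    then obtain c d where S: "\<sigma> \<in> schlicht" "\<rho> \<in> schlicht"
      and c: "\<And>z. z \<in> unit_disc \<Longrightarrow> 1 - c * ev \<sigma> z \<noteq> 0"
        "\<And>z. z \<in> unit_disc \<Longrightarrow> ev \<tau> z = ev \<sigma> z / (1 - c * ev \<sigma> z)"
      and d: "\<And>z. z \<in> unit_disc \<Longrightarrow> 1 - d * ev \<tau> z \<noteq> 0"
        "\<And>z. z \<in> unit_disc \<Longrightarrow> ev \<rho> z = ev \<tau> z / (1 - d * ev \<tau> z)"
      unfolding schlicht_rel_alt by blast
    have *: "1 - (c + d) * ev \<sigma> z = (1 - c * ev \<sigma> z) * (1 - d * ev \<tau> z)"
      if "z \<in> unit_disc" for z
      unfolding c(2)[OF that] using c(1)[OF that] by (simp add: field_simps)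
    have "1 - (c + d) * ev \<sigma> z \<noteq> 0 \<and> ev \<rho> z = ev \<sigma> z / (1 - (c + d) * ev \<sigma> z)"
      if "z \<in> unit_disc" for z
      unfolding *[OF that] using c[OF that] d[OF that] by simp
    then show "(\<sigma>, \<rho>) \<in> schlicht_rel"
      unfolding schlicht_rel_alt using S by blast
  qed
qed

definition Phi :: "disc_fun \<times> disc_fun \<Rightarrow> disc_fun set" where
  "Phi = (\<lambda>(f, \<sigma>). disc_fun.span {f * \<sigma>, f})"

end

theory Submission
  imports Defs
begin

text \<open>
  Write \<open>V\<close> for a two-dimensional space of analytic functions on the disc. Evaluating its members
  turns a point \<open>p\<close> of the disc into a functional on \<open>V\<close>. Weighted composition operators with
  constant symbols are scalar multiples of such evaluations, so if \<open>V\<close> separates points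
  then the functionals are nonzero and pairwise non-proportional (\<open>separates_points_evalD\<close>). In
  other words, the quotient of two basis elements of \<open>V\<close> is an injective map from the disc into
  the Riemann sphere.

  Such a map is not onto: if it were, removing one point from both sides would give a holomorphic
  bijection from a punctured disc onto the plane, whose inverse is a bounded nonconstant entire
  function, contradicting Liouville's theorem. An omitted value amounts to a zero-free member of
  \<open>V\<close> (\<open>nonvanishing_member\<close>). Normalise it to \<open>f\<close> with \<open>f(0) = 1\<close>, and divide by it a member of
  \<open>V\<close> vanishing at \<open>0\<close>: the quotient is injective, hence after scaling schlicht, and \<open>V\<close> is the
  span of \<open>f\<sigma>\<close> and \<open>f\<close> (\<open>V2_obtain_schlicht_form\<close>).

  Conversely, such a span separates points because \<open>f\<close> and \<open>f\<sigma>\<close> determine first the inner map,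
  through injectivity of \<open>\<sigma>\<close>, and then the weight, since \<open>f\<close> has no zeros
  (\<open>separates_points_Phi\<close>).

  The pair \<open>(f, \<sigma>)\<close> is determined by \<open>V\<close> up to choosing another zero-free member: it must have the
  form \<open>f(1 - c\<sigma>)\<close> by the normalisation at \<open>0\<close>, and then \<open>\<sigma>\<close> becomes \<open>\<sigma>/(1 - c\<sigma>)\<close>. This is
  exactly the equivalence relation on schlicht functions
  (\<open>Phi_schlicht_rel\<close>, \<open>Phi_eqD\<close>).
\<close>

section \<open>Analytic functions on the disc\<close>

lemmas ev_simps [simp] =
  zero_disc_fun.rep_eq plus_disc_fun.rep_eq minus_disc_fun.rep_eq
  uminus_disc_fun.rep_eq times_disc_fun.rep_eq scale_disc_fun.rep_eq

lemma ev_one [simp]: "z \<in> unit_disc \<Longrightarrow> ev 1 z = 1"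
  by transfer simp

lemma ev_outside: "z \<notin> unit_disc \<Longrightarrow> ev f z = 0"
  using ev[of f] by simp

lemma holomorphic_ev: "ev f holomorphic_on unit_disc"
  using ev[of f] by simp

lemma has_field_derivative_ev:
  "z \<in> unit_disc \<Longrightarrow> (ev f has_field_derivative deriv (ev f) z) (at z)"
  by (rule holomorphic_derivI[OF holomorphic_ev]) auto

lemma obtain_disc_fun:
  assumes "g holomorphic_on unit_disc"
  obtains F where "\<And>z. z \<in> unit_disc \<Longrightarrow> ev F z = g z"
proof
  have "(\<lambda>z. if z \<in> unit_disc then g z else 0) holomorphic_on unit_disc"
    by (rule holomorphic_transform[OF assms]) simp
  then show "ev (Abs_disc_fun (\<lambda>z. if z \<in> unit_disc then g z else 0)) z = g z"
    if "z \<in> unit_disc" for z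
    using that by (subst Abs_disc_fun_inverse) auto
qed

lemma disc_fun_mult_eq_0D:
  fixes f g :: disc_fun
  assumes "f * g = 0"
  shows "f = 0 \<or> g = 0"
proof (rule ccontr)
  assume neg: "\<not> (f = 0 \<or> g = 0)"
  then obtain w where w: "w \<in> unit_disc" "ev f w \<noteq> 0"
    using disc_fun_eqI[of f 0] by auto
  define U where "U = {z \<in> unit_disc. ev f z \<noteq> 0}"
  have "open U"
  proof -
    have "open (unit_disc \<inter> ev f -` (- {0}))"
      by (rule continuous_open_preimage[OF holomorphic_on_imp_continuous_on[OF holomorphic_ev]]) auto
    also have "unit_disc \<inter> ev f -` (- {0}) = U" by (auto simp: U_def)
    finally show ?thesis .
  qed
  have zero: "ev g z = 0" if "z \<in> U" for z
  proof -
    have "ev (f * g) z = 0" by (simp add: assms)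
    then show ?thesis using that by (simp add: U_def)
  qed
  have "ev g z = 0" if "z \<in> unit_disc" for z
    by (rule analytic_continuation_open[where s = U and s' = unit_disc and f = "ev g" and g = "\<lambda>_. 0"])
       (use w that zero \<open>open U\<close> holomorphic_ev in \<open>auto simp: U_def\<close>)
  then have "g = 0" by (intro disc_fun_eqI) simp
  with neg show False by simp
qed

section \<open>Spans of two functions\<close>

lemma span_pair_iff:
  "x \<in> disc_fun.span {a, b} \<longleftrightarrow> (\<exists>\<alpha> \<beta>. x = scale_disc_fun \<alpha> a + scale_disc_fun \<beta> b)"
  unfolding disc_fun.span_breakdown_eq[of x a] disc_fun.span_singleton
  by (simp add: image_iff diff_eq_eq) (metis add.commute)

text \<open>
  A third independent member of \<open>V\<close> would exceed the size of a basis. The bound is that for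
  independent subsets of a finitely spanned set, as the ambient space has infinite dimension.
\<close>

lemma span_independent_pair:
  assumes V: "disc_fun.subspace V" "disc_fun.dim V = 2"
    and uv: "u \<in> V" "v \<in> V" "u \<noteq> v" "disc_fun.independent {u, v}"
  shows "V = disc_fun.span {u, v}"
proof
  obtain B where B: "B \<subseteq> V" "disc_fun.independent B" "V \<subseteq> disc_fun.span B" "card B = 2"
    using disc_fun.basis_exists[of V] V(2) by metis
  have "finite B" using B(4) by (intro card_ge_0_finite) simp
  show "V \<subseteq> disc_fun.span {u, v}"
  proof
    fix x assume "x \<in> V"
    show "x \<in> disc_fun.span {u, v}"
    proof (rule ccontr)
      assume x: "x \<notin> disc_fun.span {u, v}"
      then have "disc_fun.independent {x, u, v}"
        using uv(4) by (rule disc_fun.independent_insertI)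
      moreover have "{x, u, v} \<subseteq> disc_fun.span B" using B(3) uv \<open>x \<in> V\<close> by auto
      ultimately have "card {x, u, v} \<le> card B"
        using disc_fun.independent_span_bound[OF \<open>finite B\<close>] by blast
      moreover have "x \<noteq> u" "x \<noteq> v" using x by (auto intro: disc_fun.span_base)
      ultimately show False using uv(3) B(4) by simp
    qed
  qed
  show "disc_fun.span {u, v} \<subseteq> V"
    by (rule disc_fun.span_minimal) (use V uv in auto)
qed

lemma independent_pairI:
  assumes "u \<noteq> 0" "\<And>c. v \<noteq> scale_disc_fun c u"
  shows "u \<noteq> v" "disc_fun.independent {u, v}"
proof -
  show "u \<noteq> v" using assms(2)[of 1] by auto
  have "v \<notin> disc_fun.span {u}" using assms(2) by (auto simp: disc_fun.span_singleton)
  then have "disc_fun.independent {v, u}"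
    using assms(1) by (intro disc_fun.independent_insertI) (auto simp: disc_fun.independent_empty)
  then show "disc_fun.independent {u, v}" by (simp add: insert_commute)
qed

section \<open>Separation and evaluation functionals\<close>

lemma ev_weighted_comp:
  assumes "self_map \<phi>" "z \<in> unit_disc"
  shows "ev ((mult_op \<psi> \<circ> comp_op \<phi>) f) z = ev \<psi> z * ev f (ev \<phi> z)"
  using assms by (simp add: mult_op_def comp_op.rep_eq self_map_def)

text \<open>
  The hypothesis says that \<open>M\<^sub>1 C\<^sub>p\<close> and \<open>M\<^sub>c C\<^sub>q\<close>, with constant symbols, agree on \<open>V\<close>. Then they
  agree everywhere; the functions \<open>1\<close> and \<open>z\<close> give \<open>c = 1\<close> and \<open>p = q\<close>. In particular \<open>c = 0\<close> is
  impossible, so the members of \<open>V\<close> have no common zero.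
\<close>

lemma separates_points_evalD:
  assumes sep: "separates_points V" and pq: "p \<in> unit_disc" "q \<in> unit_disc"
    and eq: "\<And>f. f \<in> V \<Longrightarrow> ev f p = c * ev f q"
  shows "c = 1 \<and> p = q"
proof -
  define A where "A = mult_op 1 \<circ> comp_op (scale_disc_fun p 1)"
  define B where "B = mult_op (scale_disc_fun c 1) \<circ> comp_op (scale_disc_fun q 1)"
  have self: "self_map (scale_disc_fun p 1)" "self_map (scale_disc_fun q 1)"
    using pq by (auto simp: self_map_def)
  have A: "ev (A f) z = ev f p" and B: "ev (B f) z = c * ev f q" if "z \<in> unit_disc" for f z
    unfolding A_def B_def using ev_weighted_comp[OF self(1) that] ev_weighted_comp[OF self(2) that]
      that by simp_all
  have "A \<in> weighted_comp_ops" "B \<in> weighted_comp_ops"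
    using self unfolding A_def B_def weighted_comp_ops_def by blast+
  moreover have "A f = B f" if "f \<in> V" for f
    by (rule disc_fun_eqI) (simp add: A B eq that)
  ultimately have "A = B"
    using sep unfolding separates_points_def by blast
  then have all: "ev f p = c * ev f q" for f
    using A[of 0 f] B[of 0 f] by simp
  obtain I where I: "\<And>z. z \<in> unit_disc \<Longrightarrow> ev I z = z"
    using obtain_disc_fun[of "\<lambda>z. z"] by (auto intro: holomorphic_intros)
  show ?thesis using all[of 1] all[of I] pq by (simp add: I)
qed

text \<open>
  The weight may have zeros, where nothing is learnt about the inner maps; they coincide off these
  zeros, and then everywhere because analytic functions have no zero divisors.
\<close>

lemma separates_points_Phi:
  assumes f: "f \<in> A_star" and inj: "inj_on (ev \<sigma>) unit_disc"
  shows "separates_points (Phi (f, \<sigma>))"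
  unfolding separates_points_def
proof (intro ballI impI)
  fix A B assume "A \<in> weighted_comp_ops" "B \<in> weighted_comp_ops" and ne: "A \<noteq> B"
  then obtain \<psi> \<phi> \<psi>' \<phi>' where A: "A = mult_op \<psi> \<circ> comp_op \<phi>" "self_map \<phi>"
    and B: "B = mult_op \<psi>' \<circ> comp_op \<phi>'" "self_map \<phi>'"
    unfolding weighted_comp_ops_def by blast
  have f0: "ev f z \<noteq> 0" if "z \<in> unit_disc" for z
    using f that unfolding A_star_def by force
  have im: "ev \<phi> z \<in> unit_disc" "ev \<phi>' z \<in> unit_disc" if "z \<in> unit_disc" for z
    using A(2) B(2) that unfolding self_map_def by blast+
  show "\<exists>g\<in>Phi (f, \<sigma>). A g \<noteq> B g"
  proof (rule ccontr)
    assume "\<not> ?thesis"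
    then have agree: "A g = B g" if "g \<in> Phi (f, \<sigma>)" for g
      using that by blast
    have mem: "f \<in> Phi (f, \<sigma>)" "f * \<sigma> \<in> Phi (f, \<sigma>)"
      unfolding Phi_def by (auto intro: disc_fun.span_base)
    have e: "ev \<psi> z * ev g (ev \<phi> z) = ev \<psi>' z * ev g (ev \<phi>' z)"
      if "z \<in> unit_disc" "g \<in> Phi (f, \<sigma>)" for z g
      using ev_weighted_comp[OF A(2) that(1), of \<psi> g] ev_weighted_comp[OF B(2) that(1), of \<psi>' g]
        agree[OF that(2)] unfolding A(1) B(1) by simp
    have e1: "ev \<psi> z * ev f (ev \<phi> z) = ev \<psi>' z * ev f (ev \<phi>' z)"
      and e2: "ev \<psi> z * ev f (ev \<phi> z) * ev \<sigma> (ev \<phi> z)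
        = ev \<psi>' z * ev f (ev \<phi>' z) * ev \<sigma> (ev \<phi>' z)"
      if "z \<in> unit_disc" for z
      using e[OF that mem(1)] e[OF that mem(2)]
      by (simp_all only: times_disc_fun.rep_eq mult.assoc[symmetric])
    have "\<psi> * (\<phi> - \<phi>') = 0"
    proof (rule disc_fun_eqI)
      fix z assume z: "z \<in> unit_disc"
      show "ev (\<psi> * (\<phi> - \<phi>')) z = ev 0 z"
      proof (cases "ev \<psi> z = 0")
        case False
        with e1[OF z] e2[OF z] f0 im[OF z] have "ev \<sigma> (ev \<phi> z) = ev \<sigma> (ev \<phi>' z)" by auto
        then have "ev \<phi> z = ev \<phi>' z" using inj im[OF z] by (auto dest: inj_onD)
        then show ?thesis by simp
      qed simp
    qed
    then consider "\<psi> = 0" | "\<phi> = \<phi>'" using disc_fun_mult_eq_0D by fastforce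
    then have "A = B"
    proof cases
      case 1
      have "\<psi>' = 0"
        by (rule disc_fun_eqI) (use e1 f0 im 1 in force)
      with 1 show ?thesis by (simp add: A B mult_op_def fun_eq_iff)
    next
      case 2
      have "\<psi> = \<psi>'"
        by (rule disc_fun_eqI) (use e1 f0 im 2 in force)
      with 2 show ?thesis by (simp add: A B)
    qed
    with ne show False by simp
  qed
qed

section \<open>The spans attached to schlicht functions\<close>

lemma Phi_in_V2:
  assumes f: "f \<in> A_star" and \<sigma>: "\<sigma> \<in> schlicht"
  shows "Phi (f, \<sigma>) \<in> V2"
proof -
  have f0: "ev f z \<noteq> 0" if "z \<in> unit_disc" for z
    using f that unfolding A_star_def by force
  have \<sigma>0: "ev \<sigma> 0 = 0" and inj: "inj_on (ev \<sigma>) unit_disc" using \<sigma> by (auto simp: schlicht_def)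
  have half: "(1/2 :: complex) \<in> unit_disc" "(0 :: complex) \<in> unit_disc" by auto
  have \<sigma>h: "ev \<sigma> (1/2) \<noteq> 0" using inj_onD[OF inj, of "1/2" 0] half \<sigma>0 by auto
  have "f * \<sigma> \<noteq> 0"
  proof
    assume "f * \<sigma> = 0"
    then have "ev (f * \<sigma>) (1/2) = 0" by simp
    with \<sigma>h f0 half show False by simp
  qed
  moreover have "f \<noteq> scale_disc_fun c (f * \<sigma>)" for c
  proof
    assume "f = scale_disc_fun c (f * \<sigma>)"
    then have "ev f 0 = ev (scale_disc_fun c (f * \<sigma>)) 0" by simp
    with \<sigma>0 f0 half show False by simp
  qed
  ultimately have ind: "f * \<sigma> \<noteq> f" "disc_fun.independent {f * \<sigma>, f}"
    by (rule independent_pairI)+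
  have "disc_fun.dim (Phi (f, \<sigma>)) = 2"
    using ind disc_fun.dim_eq_card_independent[OF ind(2)] by (simp add: Phi_def)
  then show ?thesis
    using separates_points_Phi[OF f inj] by (simp add: V2_def G2_def Phi_def)
qed

text \<open>
  Passing to an equivalent schlicht function divides \<open>\<sigma>\<close> by \<open>1 - c\<sigma>\<close>. Multiplying \<open>f\<close> by the same
  factor compensates for it: \<open>f\<sigma>\<close> is unchanged, and \<open>f(1 - c\<sigma>)\<close> still lies in the span.
\<close>

lemma Phi_schlicht_rel:
  assumes f: "f \<in> A_star" and rel: "(\<sigma>, \<tau>) \<in> schlicht_rel"
  obtains g where "g \<in> A_star" "Phi (g, \<tau>) = Phi (f, \<sigma>)"
proof -
  obtain c where c: "\<And>z. z \<in> unit_disc \<Longrightarrow> 1 - c * ev \<sigma> z \<noteq> 0"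
      "\<And>z. z \<in> unit_disc \<Longrightarrow> ev \<tau> z = ev \<sigma> z / (1 - c * ev \<sigma> z)"
    and \<sigma>: "\<sigma> \<in> schlicht"
    using rel unfolding schlicht_rel_alt by blast
  define g where "g = f + scale_disc_fun (- c) (f * \<sigma>)"
  have evg: "ev g z = ev f z * (1 - c * ev \<sigma> z)" for z
    by (simp add: g_def algebra_simps)
  have gA: "g \<in> A_star"
    using f c(1) \<sigma> unfolding A_star_def schlicht_def by (auto simp: evg)
  have gt: "g * \<tau> = f * \<sigma>"
    by (rule disc_fun_eqI) (use c in \<open>simp add: evg\<close>)
  have "disc_fun.span {f * \<sigma>, g} = disc_fun.span {f * \<sigma>, f}"
    unfolding g_def
  proof (intro disc_fun.span_eq[THEN iffD2] conjI)
    show "{f * \<sigma>, f + scale_disc_fun (- c) (f * \<sigma>)} \<subseteq> disc_fun.span {f * \<sigma>, f}"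
      by (auto intro: disc_fun.span_diff disc_fun.span_scale disc_fun.span_base)
    have "(f + scale_disc_fun (- c) (f * \<sigma>)) + scale_disc_fun c (f * \<sigma>)
        \<in> disc_fun.span {f * \<sigma>, f + scale_disc_fun (- c) (f * \<sigma>)}"
      by (intro disc_fun.span_add disc_fun.span_scale disc_fun.span_base) auto
    then show "{f * \<sigma>, f} \<subseteq> disc_fun.span {f * \<sigma>, f + scale_disc_fun (- c) (f * \<sigma>)}"
      by (auto intro: disc_fun.span_base)
  qed
  then have "Phi (g, \<tau>) = Phi (f, \<sigma>)" by (simp add: Phi_def gt)
  with gA that show thesis by blast
qed

text \<open>
  Both generators of one span are combinations of those of the other. The values at \<open>0\<close> leave
  \<open>g = f(1 + b\<sigma>)\<close> and \<open>g\<tau> = d f\<sigma>\<close>, and the derivatives at \<open>0\<close> give \<open>d = 1\<close>.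
  So \<open>\<tau> = \<sigma>/(1 + b\<sigma>)\<close>, which for \<open>\<tau> = \<sigma>\<close> reads \<open>b\<sigma>\<^sup>2 = 0\<close> and forces \<open>b = 0\<close>.
\<close>

lemma Phi_eqD:
  assumes f: "f \<in> A_star" and g: "g \<in> A_star" and \<sigma>: "\<sigma> \<in> schlicht" and \<tau>: "\<tau> \<in> schlicht"
    and eq: "Phi (f, \<sigma>) = Phi (g, \<tau>)"
  shows "(\<sigma>, \<tau>) \<in> schlicht_rel" and "\<sigma> = \<tau> \<Longrightarrow> f = g"
proof -
  have f0: "ev f z \<noteq> 0" and g0: "ev g z \<noteq> 0" if "z \<in> unit_disc" for z
    using f g that unfolding A_star_def by force+
  have at0: "ev f 0 = 1" "ev g 0 = 1" "ev \<sigma> 0 = 0" "ev \<tau> 0 = 0"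
      "deriv (ev \<sigma>) 0 = 1" "deriv (ev \<tau>) 0 = 1"
    using f g \<sigma> \<tau> by (auto simp: A_star_def schlicht_def)
  have "g \<in> Phi (f, \<sigma>)" "g * \<tau> \<in> Phi (f, \<sigma>)"
    unfolding eq by (auto simp: Phi_def intro: disc_fun.span_base)
  then obtain a b c d where
    gfa: "g = scale_disc_fun b (f * \<sigma>) + scale_disc_fun a f" and
    gtc: "g * \<tau> = scale_disc_fun d (f * \<sigma>) + scale_disc_fun c f"
    unfolding Phi_def by (auto simp: span_pair_iff)
  have "ev g 0 = a" "ev (g * \<tau>) 0 = c"
    unfolding gtc by (subst gfa) (simp_all add: at0)
  then have ac: "a = 1" "c = 0" using at0 by auto
  have evg: "ev g z = ev f z * (1 + b * ev \<sigma> z)" for z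
    by (subst gfa) (simp add: ac algebra_simps)
  have "ev (g * \<tau>) z = d * ev f z * ev \<sigma> z" for z
    by (subst gtc) (simp add: ac)
  then have evgt: "ev f z * (1 + b * ev \<sigma> z) * ev \<tau> z = d * ev f z * ev \<sigma> z" for z
    by (simp add: evg)
  have rel: "(1 + b * ev \<sigma> z) * ev \<tau> z = d * ev \<sigma> z" for z
    using evgt[of z] f0[of z] by (cases "z \<in> unit_disc") (auto simp: ev_outside)
  have "((\<lambda>z. (1 + b * ev \<sigma> z) * ev \<tau> z) has_field_derivative 1) (at 0)"
    using has_field_derivative_ev[of 0 \<sigma>] has_field_derivative_ev[of 0 \<tau>]
    by (auto intro!: derivative_eq_intros simp: at0)
  moreover have "((\<lambda>z. d * ev \<sigma> z) has_field_derivative d) (at 0)"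
    using has_field_derivative_ev[of 0 \<sigma>] by (auto intro!: derivative_eq_intros simp: at0)
  ultimately have d: "d = 1" unfolding rel by (metis DERIV_unique)
  have nz: "1 + b * ev \<sigma> z \<noteq> 0" if "z \<in> unit_disc" for z
    using g0[OF that] evg[of z] by auto
  have "\<forall>z\<in>unit_disc. 1 - (- b) * ev \<sigma> z \<noteq> 0 \<and> ev \<tau> z = ev \<sigma> z / (1 - (- b) * ev \<sigma> z)"
    using nz rel d by (auto simp: divide_simps mult.commute)
  then show "(\<sigma>, \<tau>) \<in> schlicht_rel"
    unfolding schlicht_rel_alt using \<sigma> \<tau> by blast
  assume "\<sigma> = \<tau>"
  with rel[of "1/2"] d have "b * ev \<sigma> (1/2) * ev \<sigma> (1/2) = 0" by (simp add: algebra_simps)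
  moreover have "ev \<sigma> (1/2) \<noteq> 0"
    using \<sigma> inj_onD[of "ev \<sigma>" unit_disc "1/2" 0] by (auto simp: schlicht_def)
  ultimately have "b = 0" by simp
  then show "f = g" by (intro disc_fun_eqI) (simp add: evg)
qed

section \<open>Zero-free members of a separating space\<close>

text \<open>
  The last hypothesis says that \<open>u/v\<close> is injective as a map into the Riemann sphere. As it takes
  the value infinity at \<open>0\<close>, it is an injective holomorphic function on the punctured disc. If
  each \<open>u - cv\<close> had a zero, then \<open>u/v\<close> would map the punctured disc onto the plane, and its
  inverse would be a bounded nonconstant entire function.
\<close>

lemma nonvanishing_member:
  assumes u0: "ev u 0 \<noteq> 0" and v0: "ev v 0 = 0"
    and inj: "\<And>p q. p \<in> unit_disc \<Longrightarrow> q \<in> unit_disc \<Longrightarrow>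
      ev u p * ev v q = ev u q * ev v p \<Longrightarrow> p = q"
  obtains c where "\<And>z. z \<in> unit_disc \<Longrightarrow> ev u z - c * ev v z \<noteq> 0"
proof (rule ccontr)
  assume "\<not> thesis"
  with that have zero: "\<exists>z\<in>unit_disc. ev u z - c * ev v z = 0" for c by blast
  define D where "D = unit_disc - {0 :: complex}"
  have D: "open D" "D \<subseteq> unit_disc" unfolding D_def by auto
  have v: "ev v z \<noteq> 0" if "z \<in> D" for z
    using inj[of z 0] that v0 by (auto simp: D_def)
  define g where "g = (\<lambda>z. ev u z / ev v z)"
  have "g holomorphic_on D"
    unfolding g_def by (intro holomorphic_on_divide holomorphic_on_subset[OF holomorphic_ev D(2)] v)
  moreover have "inj_on g D"
  proof (rule inj_onI)
    fix p q assume pq: "p \<in> D" "q \<in> D" "g p = g q"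
    then have "ev u p * ev v q = ev u q * ev v p"
      using v by (simp add: g_def field_simps)
    with pq inj D(2) show "p = q" by blast
  qed
  ultimately obtain h where h: "h holomorphic_on (g ` D)" "\<And>z. z \<in> D \<Longrightarrow> h (g z) = z"
    using holomorphic_has_inverse[of g D] D(1) by metis
  have surj: "\<exists>z\<in>D. g z = c" for c
  proof -
    obtain z where z: "z \<in> unit_disc" "ev u z - c * ev v z = 0" using zero by blast
    then have "z \<in> D" using u0 v0 by (auto simp: D_def)
    with z v have "g z = c" by (simp add: g_def)
    with \<open>z \<in> D\<close> show ?thesis by blast
  qed
  then have "c \<in> g ` D" for c by (metis image_eqI)
  then have "g ` D = UNIV" by auto
  with h have "h holomorphic_on UNIV" by simp
  moreover have "range h \<subseteq> unit_disc"
  proof (rule image_subsetI)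
    fix c
    obtain z where "z \<in> D" "g z = c" using surj by blast
    with h(2) D(2) show "h c \<in> unit_disc" by auto
  qed
  then have "bounded (range h)" using bounded_subset bounded_ball by blast
  ultimately have "h constant_on UNIV" by (rule Liouville_theorem)
  then obtain k where "\<And>w. h w = k" by (auto simp: constant_on_def)
  then have "z = k" if "z \<in> D" for z using h(2)[OF that] by simp
  from this[of "1/2"] this[of "1/3"] show False by (auto simp: D_def)
qed

text \<open>
  Injectivity is used twice, for quotients of a function vanishing at \<open>0\<close> and one that does not:
  it provides the zero-free member \<open>f\<close>, and it makes \<open>s = v/f\<close> an injective holomorphic function,
  whose derivative at \<open>0\<close> is therefore nonzero, so that dividing by it normalises \<open>s\<close>.
\<close>

lemma V2_obtain_schlicht_form:
  assumes "V \<in> V2"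
  obtains f \<sigma> where "f \<in> A_star" "\<sigma> \<in> schlicht" "V = Phi (f, \<sigma>)"
proof -
  have V: "disc_fun.subspace V" "disc_fun.dim V = 2" and sep: "separates_points V"
    using assms by (auto simp: V2_def G2_def)
  \<comment> \<open>With the constant \<open>0\<close>, non-proportionality says that \<open>0\<close> is not a common zero.\<close>
  obtain u where u: "u \<in> V" "ev u 0 \<noteq> 0"
    using separates_points_evalD[OF sep, of 0 0 0] by auto
  have "\<not> V \<subseteq> disc_fun.span {u}"
    using disc_fun.dim_le_card[of V "{u}"] V(2) by auto
  then obtain x where x: "x \<in> V" "x \<notin> disc_fun.span {u}" by blast
  define v where "v = x - scale_disc_fun (ev x 0 / ev u 0) u"
  have vV: "v \<in> V"
    unfolding v_def by (intro disc_fun.subspace_diff disc_fun.subspace_scale V x u)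
  have v0: "ev v 0 = 0" using u by (simp add: v_def)
  have "v \<noteq> 0" using x(2) by (auto simp: v_def disc_fun.span_singleton)
  have "u \<noteq> 0" using u by auto
  have span: "V = disc_fun.span {w, v}" if "w \<in> V" "ev w 0 \<noteq> 0" for w
  proof -
    have w: "w \<noteq> 0" using that by auto
    have "v \<noteq> scale_disc_fun c w" for c
    proof
      assume *: "v = scale_disc_fun c w"
      then have "c * ev w 0 = 0" using v0 by simp
      then have "c = 0" using that by simp
      with * \<open>v \<noteq> 0\<close> show False by simp
    qed
    from independent_pairI[OF w this] show ?thesis
      using span_independent_pair V that vV by blast
  qed
  have inj: "p = q" if w: "w \<in> V" "ev w 0 \<noteq> 0" and pq: "p \<in> unit_disc" "q \<in> unit_disc"
      and eq: "ev w p * ev v q = ev w q * ev v p" for w p q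
  proof (cases "ev w q = 0 \<and> ev v q = 0")
    case True
    have "ev h q = 0 * ev h q" if "h \<in> V" for h
      using that True unfolding span[OF w] span_pair_iff by auto
    from separates_points_evalD[OF sep pq(2) pq(2) this] show ?thesis by simp
  next
    case False
    \<comment> \<open>The ratio of the two evaluations is read off from whichever function is nonzero at \<open>q\<close>.\<close>
    define c where "c = (if ev w q = 0 then ev v p / ev v q else ev w p / ev w q)"
    have "ev w p = c * ev w q" "ev v p = c * ev v q"
      using False eq by (auto simp: c_def field_simps)
    then have "ev h p = c * ev h q" if "h \<in> V" for h
      using that unfolding span[OF w] span_pair_iff by (auto simp: algebra_simps)
    from separates_points_evalD[OF sep pq this] show ?thesis by simp
  qed
  obtain c where c: "\<And>z. z \<in> unit_disc \<Longrightarrow> ev u z - c * ev v z \<noteq> 0"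
    using nonvanishing_member[OF u(2) v0 inj[OF u]] by metis
  define f where "f = scale_disc_fun (1 / ev u 0) (u - scale_disc_fun c v)"
  have fV: "f \<in> V"
    unfolding f_def by (intro disc_fun.subspace_diff disc_fun.subspace_scale V vV u)
  have f0: "ev f z \<noteq> 0" if "z \<in> unit_disc" for z
    using c[OF that] u by (simp add: f_def)
  have f1: "ev f 0 = 1" using u v0 by (simp add: f_def)
  have fA: "f \<in> A_star" using f0 f1 by (auto simp: A_star_def)
  define s where "s = (\<lambda>z. ev v z / ev f z)"
  have s: "s holomorphic_on unit_disc"
    unfolding s_def by (intro holomorphic_on_divide holomorphic_ev f0)
  have s_inj: "inj_on s unit_disc"
  proof (rule inj_onI)
    fix p q assume pq: "p \<in> unit_disc" "q \<in> unit_disc" "s p = s q"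
    then have "ev f p * ev v q = ev f q * ev v p"
      using f0 by (simp add: s_def field_simps)
    then show "p = q" using inj[OF fV _ pq(1,2)] f1 by simp
  qed
  define d where "d = deriv s 0"
  have d: "d \<noteq> 0"
    unfolding d_def by (rule holomorphic_injective_imp_regular[OF s _ s_inj]) auto
  obtain \<sigma> where \<sigma>: "\<And>z. z \<in> unit_disc \<Longrightarrow> ev \<sigma> z = s z / d"
    by (rule obtain_disc_fun[OF holomorphic_on_divide[OF s holomorphic_on_const]]) (use d in auto)
  have "\<sigma> \<in> schlicht"
  proof -
    have "inj_on (ev \<sigma>) unit_disc"
      using s_inj d by (auto simp: inj_on_def \<sigma>)
    moreover have "ev \<sigma> 0 = 0" by (simp add: \<sigma> s_def v0)
    moreover have "deriv (ev \<sigma>) 0 = 1"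
    proof -
      have "(s has_field_derivative d) (at 0)"
        unfolding d_def by (rule holomorphic_derivI[OF s]) auto
      then have "((\<lambda>z. s z / d) has_field_derivative 1) (at 0)"
        using DERIV_cdivide[of s d 0 UNIV d] d by simp
      then have "(ev \<sigma> has_field_derivative 1) (at 0)"
        by (rule has_field_derivative_transform_within_open[where S = unit_disc]) (auto simp: \<sigma>)
      then show ?thesis by (rule DERIV_imp_deriv)
    qed
    ultimately show ?thesis by (simp add: schlicht_def)
  qed
  moreover have "V = Phi (f, \<sigma>)"
  proof -
    have fs: "f * \<sigma> = scale_disc_fun (1 / d) v"
      by (rule disc_fun_eqI) (use f0 in \<open>simp add: \<sigma> s_def\<close>)
    have "f * \<sigma> \<noteq> 0" using \<open>v \<noteq> 0\<close> d by (simp add: fs)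
    moreover have "f \<noteq> scale_disc_fun k (f * \<sigma>)" for k
    proof
      assume "f = scale_disc_fun k (f * \<sigma>)"
      then have "ev f 0 = k * (1 / d * ev v 0)" by (metis fs scale_disc_fun.rep_eq)
      with v0 f1 show False by simp
    qed
    ultimately have "f * \<sigma> \<noteq> f" "disc_fun.independent {f * \<sigma>, f}"
      by (rule independent_pairI)+
    moreover have "f * \<sigma> \<in> V"
      unfolding fs by (intro disc_fun.subspace_scale V vV)
    ultimately show ?thesis
      using span_independent_pair[OF V _ fV] by (simp add: Phi_def)
  qed
  ultimately show thesis using that fA by blast
qed

section \<open>The bijection\<close>

theorem theorem2:
  fixes S' :: "disc_fun set"
  assumes "S' \<subseteq> schlicht"
    and "\<forall>C \<in> schlicht // schlicht_rel. \<exists>!\<sigma>. \<sigma> \<in> S' \<inter> C"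
  shows "bij_betw Phi (A_star \<times> S') V2"
proof (rule bij_betw_imageI)
  show "inj_on Phi (A_star \<times> S')"
  proof (rule inj_onI, clarify)
    fix f \<sigma> g \<tau>
    assume fg: "f \<in> A_star" "g \<in> A_star" and S: "\<sigma> \<in> S'" "\<tau> \<in> S'"
      and eq: "Phi (f, \<sigma>) = Phi (g, \<tau>)"
    have sch: "\<sigma> \<in> schlicht" "\<tau> \<in> schlicht" using S assms(1) by auto
    have "(\<sigma>, \<tau>) \<in> schlicht_rel" by (rule Phi_eqD[OF fg sch eq])
    then have "\<tau> \<in> S' \<inter> schlicht_rel `` {\<sigma>}" using S by simp
    moreover have "\<sigma> \<in> S' \<inter> schlicht_rel `` {\<sigma>}"
      using S equiv_class_self[OF equiv_schlicht_rel sch(1)] by simp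
    moreover have "schlicht_rel `` {\<sigma>} \<in> schlicht // schlicht_rel"
      using sch by (intro quotientI)
    ultimately have "\<sigma> = \<tau>" using assms(2) by (metis (no_types, lifting))
    with Phi_eqD(2)[OF fg sch eq] show "f = g \<and> \<sigma> = \<tau>" by simp
  qed
  show "Phi ` (A_star \<times> S') = V2"
  proof
    show "Phi ` (A_star \<times> S') \<subseteq> V2" using Phi_in_V2 assms(1) by auto
    show "V2 \<subseteq> Phi ` (A_star \<times> S')"
    proof
      fix V assume "V \<in> V2"
      then obtain f \<sigma> where f: "f \<in> A_star" "\<sigma> \<in> schlicht" "V = Phi (f, \<sigma>)"
        by (rule V2_obtain_schlicht_form)
      then have "schlicht_rel `` {\<sigma>} \<in> schlicht // schlicht_rel" by (intro quotientI)
      with assms(2) have "\<exists>!\<tau>. \<tau> \<in> S' \<inter> schlicht_rel `` {\<sigma>}" by (rule bspec)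
      then obtain \<tau> where "\<tau> \<in> S'" "(\<sigma>, \<tau>) \<in> schlicht_rel" by auto
      moreover obtain g where "g \<in> A_star" "Phi (g, \<tau>) = Phi (f, \<sigma>)"
        using Phi_schlicht_rel[OF f(1) \<open>(\<sigma>, \<tau>) \<in> schlicht_rel\<close>] by blast
      ultimately show "V \<in> Phi ` (A_star \<times> S')"
        using f(3) by (intro image_eqI[of _ _ "(g, \<tau>)"]) auto
    qed
  qed
qed

end
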